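(* Let $K\subset\mathcal M(\mathbb R_+)$. Then the following statements are equivalent: (i) The identity $[0,\infty)\to[0,\infty)$, $s\mapsto s$, is uniformly integrable for $K$. (ii) There exists a nondecreasing function $\psi\colon[0,\infty)\to[0,\infty)$ with $\psi(0)=0$ such that $[0,\infty)\to[0,\infty)$, $s\mapsto\frac{\psi(s)}{s}$ is nondecreasing, $\frac{\psi(s)}{s}\to\infty$ as $s\to\infty$ and $$\sup_{\nu\in K}\int_0^\infty\psi(s)\,d\nu(s)<\infty.$$ The function $\psi$ in (ii) can be chosen to be continuously differentiable, convex and uniformly integrable for $K$. When (i) and (ii) hold, the function $\psi$ can additionally be chosen to be strictly convex (and thus strictly increasing) if and only if $$\sup_{\nu\in K}\nu((s,\infty))<\infty\quad\text{for all } s>0.$$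
   Context: $\mathbb R_+=[0,\infty)$, and $\mathcal M(\mathbb R_+)$ is the set of all (possibly nonfinite) measures $\mu\colon\mathcal B(\mathbb R_+)\to[0,\infty]$ on the Borel $\sigma$-algebra of $\mathbb R_+$. For $K\subset\mathcal M(\mathbb R_+)$, a nondecreasing map $\varphi\colon[0,\infty)\to[0,\infty)$ is uniformly integrable for $K$ if $\sup_{\nu\in K}\int_M^\infty\varphi(s)\,d\nu(s)\to0$ as $M\to\infty$. The convention $\frac00:=0$ is used. *)

theory Defs
  imports "HOL-Analysis.Analysis"
begin

text \<open>
  Functions on \<open>[0,\<infinity>)\<close> are represented by functions \<open>real \<Rightarrow> real\<close>; every property below, and every
  integral against a measure on \<open>[0,\<infinity>)\<close>, only depends on their values on \<open>{0..}\<close>.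
\<close>

definition measures_Rplus :: "real measure set" where
  "measures_Rplus = {\<mu>. sets \<mu> = sets (restrict_space borel {0..})}"

text \<open>
  The supremum is taken in \<open>[0,\<infinity>]\<close>: it is \<open>0\<close> for empty \<open>K\<close> and may be infinite for small \<open>M\<close>.
\<close>

definition uniformly_integrable_for :: "(real \<Rightarrow> real) \<Rightarrow> real measure set \<Rightarrow> bool" where
  "uniformly_integrable_for \<phi> K \<longleftrightarrow>
     \<phi> \<in> {0..} \<rightarrow> {0..} \<and> mono_on {0..} \<phi> \<and>
     ((\<lambda>M. SUP \<nu>\<in>K. \<integral>\<^sup>+s\<in>{M..}. ennreal (\<phi> s) \<partial>\<nu>) \<longlongrightarrow> 0) at_top"

text \<open>
  The conditions on \<open>\<psi>\<close> in the de la Vallee-Poussin type criterion. The convention \<open>0/0 = 0\<close> for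
  \<open>\<psi> s / s\<close> at \<open>s = 0\<close> is that of HOL.
\<close>

definition integrability_test_function :: "(real \<Rightarrow> real) \<Rightarrow> real measure set \<Rightarrow> bool" where
  "integrability_test_function \<psi> K \<longleftrightarrow>
     \<psi> \<in> {0..} \<rightarrow> {0..} \<and> mono_on {0..} \<psi> \<and> \<psi> 0 = 0 \<and>
     mono_on {0..} (\<lambda>s. \<psi> s / s) \<and>
     filterlim (\<lambda>s. \<psi> s / s) at_top at_top \<and>
     (SUP \<nu>\<in>K. \<integral>\<^sup>+s\<in>{0..}. ennreal (\<psi> s) \<partial>\<nu>) < \<infinity>"

text \<open>
  The derivative at a boundary point of \<open>S\<close> is taken within \<open>S\<close>, so at \<open>0\<close> it is one-sided for
  \<open>S = {0..}\<close>. (The library's \<open>C1_differentiable_on\<close> demands two-sided derivatives.)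
\<close>

definition continuously_differentiable_on :: "real set \<Rightarrow> (real \<Rightarrow> real) \<Rightarrow> bool" where
  "continuously_differentiable_on S f \<longleftrightarrow>
     (\<exists>f'. (\<forall>x\<in>S. (f has_real_derivative f' x) (at x within S)) \<and> continuous_on S f')"

definition strictly_convex_on :: "'a::real_vector set \<Rightarrow> ('a \<Rightarrow> real) \<Rightarrow> bool" where
  "strictly_convex_on S f \<longleftrightarrow> convex S \<and>
     (\<forall>x\<in>S. \<forall>y\<in>S. \<forall>u>0. \<forall>v>0. x \<noteq> y \<and> u + v = 1 \<longrightarrow>
        f (u *\<^sub>R x + v *\<^sub>R y) < u * f x + v * f y)"

end

theory Submission
  imports Defs
begin

text \<open>
  Let \<open>G M\<close> be the supremum over \<open>K\<close> of the integrals of \<open>s\<close> over \<open>[M,\<infinity>)\<close>, and let \<open>q\<close> be a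
  \<open>C\<^sup>1\<close> convex function that vanishes on \<open>(-\<infinity>,0]\<close>, is strictly convex on \<open>[0,\<infinity>)\<close> and satisfies
  \<open>q t \<le> max 0 t\<close> and \<open>q t \<ge> t - 1\<close>. If \<open>G (a n) \<le> 4\<^sup>-\<^sup>n\<close> then \<open>\<Sum>n. q (s - a n)\<close> is superlinear, and
  its integral over \<open>[M,\<infinity>)\<close> is at most \<open>\<Sum>n. min (G M) (4\<^sup>-\<^sup>n)\<close>. Adding small multiples of
  \<open>q (s - 1/(n+1))\<close> makes it strictly convex; the integrals stay bounded if every \<open>G (1/(n+1))\<close> is
  finite, which is the condition on \<open>\<nu> ((s,\<infinity>))\<close>.
\<close>

section \<open>The smooth ramp and its derivative\<close>

definition smooth_ramp :: "real \<Rightarrow> real" where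
  "smooth_ramp t = (max 0 t)\<^sup>2 / (1 + max 0 t)"

text \<open>For \<open>t\<close> \<ge> 0 the ramp equals \<open>t - 1 + 1 / (1 + t)\<close>, which
  explains both this derivative and the asymptote \<open>t - 1\<close>. The truncation
  \<open>max 0 t\<close> extends both functions by 0 to negative arguments.\<close>

definition smooth_ramp_deriv :: "real \<Rightarrow> real" where
  "smooth_ramp_deriv t = 1 - 1 / (1 + max 0 t)\<^sup>2"

lemma smooth_ramp_nonneg: "0 \<le> smooth_ramp t"
  by (simp add: smooth_ramp_def)

lemma smooth_ramp_eq_0: "t \<le> 0 \<Longrightarrow> smooth_ramp t = 0"
  by (simp add: smooth_ramp_def)

lemma smooth_ramp_le: "smooth_ramp t \<le> max 0 t"
proof (cases "0 < t")
  case True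
  then have "t\<^sup>2 \<le> t * (1 + t)"
    by (simp add: power2_eq_square algebra_simps)
  with True show ?thesis by (simp add: smooth_ramp_def pos_divide_le_eq)
qed (simp add: smooth_ramp_eq_0)

lemma smooth_ramp_ge: "t - 1 \<le> smooth_ramp t"
proof (cases "0 < t")
  case True
  have "(t - 1) * (1 + t) \<le> t\<^sup>2"
    by (simp add: power2_eq_square algebra_simps)
  with True show ?thesis by (simp add: smooth_ramp_def pos_le_divide_eq)
qed (simp add: smooth_ramp_eq_0)

lemma smooth_ramp_deriv_nonneg: "0 \<le> smooth_ramp_deriv t"
  using one_le_power[of "1 + max 0 t" 2] by (simp add: smooth_ramp_deriv_def divide_le_eq_1)

lemma smooth_ramp_deriv_le_1: "smooth_ramp_deriv t \<le> 1"
  by (simp add: smooth_ramp_deriv_def)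

lemma smooth_ramp_deriv_eq_0: "t \<le> 0 \<Longrightarrow> smooth_ramp_deriv t = 0"
  by (simp add: smooth_ramp_deriv_def)

lemma smooth_ramp_deriv_mono: "s \<le> t \<Longrightarrow> smooth_ramp_deriv s \<le> smooth_ramp_deriv t"
  unfolding smooth_ramp_deriv_def by (intro diff_mono divide_left_mono power_mono) auto

text \<open>The derivative is 0 up to the origin and strictly increasing from there, so only the
  larger point has to be positive; \<open>s\<close> may lie in the flat part.\<close>

lemma smooth_ramp_deriv_strict_mono:
  assumes "s < t" "0 < t"
  shows "smooth_ramp_deriv s < smooth_ramp_deriv t"
proof -
  have "(1 + max 0 s)\<^sup>2 < (1 + max 0 t)\<^sup>2"
    using assms by (intro power_strict_mono) auto
  moreover have "0 < (1 + max 0 s)\<^sup>2"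
    by (intro zero_less_power) auto
  ultimately have "1 / (1 + max 0 t)\<^sup>2 < 1 / (1 + max 0 s)\<^sup>2"
    by (intro divide_strict_left_mono mult_pos_pos) auto
  then show ?thesis
    by (simp add: smooth_ramp_deriv_def)
qed

lemma continuous_on_smooth_ramp: "continuous_on A smooth_ramp"
proof -
  have "1 + max 0 t \<noteq> 0" for t :: real by linarith
  then show ?thesis unfolding smooth_ramp_def[abs_def] by (intro continuous_intros) auto
qed

lemma continuous_on_smooth_ramp_deriv: "continuous_on A smooth_ramp_deriv"
proof -
  have "(1 + max 0 t)\<^sup>2 \<noteq> 0" for t :: real by (smt (verit) zero_less_power)
  then show ?thesis unfolding smooth_ramp_deriv_def[abs_def] by (intro continuous_intros) auto
qed

lemma has_real_derivative_smooth_ramp: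
  "(smooth_ramp has_real_derivative smooth_ramp_deriv t) (at t)"
proof (cases t "0 :: real" rule: linorder_cases)
  case less
  have "((\<lambda>_. 0) has_real_derivative smooth_ramp_deriv t) (at t)"
    using less by (simp add: smooth_ramp_deriv_eq_0)
  then show ?thesis
    by (rule has_field_derivative_transform_within_open[of _ _ _ "{..<0}"])
       (use less in \<open>auto simp: smooth_ramp_eq_0\<close>)
next
  case greater
  have "((\<lambda>x. x\<^sup>2 / (1 + x)) has_real_derivative (2 * t * (1 + t) - t\<^sup>2) / (1 + t)\<^sup>2) (at t)"
    using greater by (auto intro!: derivative_eq_intros simp: power2_eq_square)
  moreover have "2 * t * (1 + t) - t\<^sup>2 = (1 + t)\<^sup>2 - 1"
    by (simp add: power2_eq_square algebra_simps)
  ultimately have "((\<lambda>x. x\<^sup>2 / (1 + x)) has_real_derivative smooth_ramp_deriv t) (at t)"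
    using greater by (simp add: smooth_ramp_deriv_def diff_divide_distrib)
  then show ?thesis
    by (rule has_field_derivative_transform_within_open[of _ _ _ "{0<..}"])
       (use greater in \<open>auto simp: smooth_ramp_def\<close>)
next
  case equal
  \<comment> \<open>For \<open>h\<close> \<noteq> 0 of either sign this is the difference quotient
    of the ramp at 0, so both one-sided limits are treated at once.\<close>
  have "((\<lambda>h. max 0 h / (1 + max 0 h)) \<longlongrightarrow> max 0 0 / (1 + max 0 0)) (at (0::real))"
    by (intro tendsto_intros) auto
  then have "((\<lambda>h. max 0 h / (1 + max 0 h)) \<longlongrightarrow> 0) (at (0::real))"
    by simp
  moreover have "\<forall>\<^sub>F h in at (0::real). max 0 h / (1 + max 0 h) = (smooth_ramp (0 + h) - smooth_ramp 0) / h"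
    by (auto simp: eventually_at_filter smooth_ramp_def max_def power2_eq_square)
  ultimately have "((\<lambda>h. (smooth_ramp (0 + h) - smooth_ramp 0) / h) \<longlongrightarrow> 0) (at (0::real))"
    by (rule Lim_transform_eventually)
  then show ?thesis
    by (simp add: equal DERIV_def smooth_ramp_deriv_eq_0)
qed

section \<open>Convexity on an interval and on the half-line\<close>

lemma strictly_convex_on_realI:
  fixes f f' :: "real \<Rightarrow> real"
  assumes "convex S"
    and deriv: "\<And>x. x \<in> S \<Longrightarrow> (f has_real_derivative f' x) (at x)"
    and mono: "strict_mono_on S f'"
  shows "strictly_convex_on S f"
proof -
  have *: "f (u * x + v * y) < u * f x + v * f y"
    if xy: "x \<in> S" "y \<in> S" "x < y" and uv: "u > 0" "v > 0" "u + v = 1" for x y u v :: real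
  proof -
    define z where "z = u * x + v * y"
    have u: "u = 1 - v" using uv by simp
    have zx: "z - x = v * (y - x)" and yz: "y - z = u * (y - x)"
      by (simp_all add: z_def u algebra_simps)
    have "x < z" "z < y"
      using zx yz uv xy by (smt (verit) mult_pos_pos)+
    have S: "w \<in> S" if "x \<le> w" "w \<le> y" for w
      using that xy \<open>convex S\<close> by (meson mem_is_interval_1_I is_interval_convex_1)
    \<comment> \<open>The mean value theorem on both sides of \<open>z\<close> turns the chord
      slopes into values of \<open>f'\<close> at points \<open>p < z < r\<close>. Since
      \<open>z - x = v * (y - x)\<close> and \<open>y - z = u * (y - x)\<close>, the factor
      \<open>u * v * (y - x)\<close> converts \<open>f' p < f' r\<close> into the convexity
      inequality.\<close>
    obtain p where p: "x < p" "p < z" "f z - f x = (z - x) * f' p"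
      using MVT2[OF \<open>x < z\<close>, of f f'] deriv S \<open>z < y\<close> by auto
    obtain r where r: "z < r" "r < y" "f y - f z = (y - z) * f' r"
      using MVT2[OF \<open>z < y\<close>, of f f'] deriv S \<open>x < z\<close> by auto
    have "f' p < f' r"
      by (rule strict_mono_onD[OF mono]) (use p r \<open>x < z\<close> \<open>z < y\<close> S in auto)
    then have "u * v * (y - x) * f' p < u * v * (y - x) * f' r"
      using uv xy by (intro mult_strict_left_mono) auto
    then have "u * (f z - f x) < v * (f y - f z)"
      unfolding p r zx yz by (simp add: mult_ac)
    then have "(u + v) * f z < u * f x + v * f y"
      by (simp add: algebra_simps)
    then show ?thesis using uv by (simp add: z_def)
  qed
  have "f (u * x + v * y) < u * f x + v * f y"
    if xy: "x \<in> S" "y \<in> S" "x \<noteq> y" and uv: "u > 0" "v > 0" "u + v = 1" for x y u v :: real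
    using *[of x y u v] *[of y x v u] that by (cases "x < y") (auto simp: add.commute)
  then show ?thesis
    using assms(1) by (auto simp: strictly_convex_on_def)
qed

text \<open>For 0 < \<open>x\<close> \<le> \<open>y\<close>, the point \<open>x\<close> is the
  convex combination of 0 and \<open>y\<close> with weight \<open>x / y\<close> on \<open>y\<close>,
  and \<open>f 0 = 0\<close>. At \<open>x = 0\<close> the quotient is 0 by convention, which is the
  least value because \<open>f\<close> is nonnegative.\<close>

lemma convex_on_mono_on_divide_self:
  fixes f :: "real \<Rightarrow> real"
  assumes conv: "convex_on {0..} f" and "f 0 = 0" and nonneg: "\<And>x. 0 \<le> x \<Longrightarrow> 0 \<le> f x"
  shows "mono_on {0..} (\<lambda>x. f x / x)"
proof (rule mono_onI)
  fix x y :: real assume xy: "x \<in> {0..}" "y \<in> {0..}" "x \<le> y"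
  show "f x / x \<le> f y / y"
  proof (cases "x = 0")
    case True
    then show ?thesis using xy nonneg by simp
  next
    case False
    have "f ((1 - x / y) *\<^sub>R 0 + (x / y) *\<^sub>R y) \<le> (1 - x / y) * f 0 + (x / y) * f y"
      by (rule convex_onD[OF conv]) (use xy False in auto)
    then have "f x \<le> (x / y) * f y"
      using False xy \<open>f 0 = 0\<close> by simp
    then show ?thesis
      using False xy by (simp add: divide_simps mult.commute split: if_splits)
  qed
qed

text \<open>The chord from the origin lies strictly above \<open>f\<close>, so
  \<open>f (v * y) < v * f y\<close> for 0 < \<open>v\<close> < 1. With \<open>v = 1/2\<close>,
  nonnegativity forces \<open>f y > 0\<close>, and then \<open>v * f y\<close> is at most
  \<open>f y\<close>.\<close>

lemma strictly_convex_on_imp_strict_mono_on: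
  fixes f :: "real \<Rightarrow> real"
  assumes conv: "strictly_convex_on {0..} f" and "f 0 = 0" and nonneg: "\<And>x. 0 \<le> x \<Longrightarrow> 0 \<le> f x"
  shows "strict_mono_on {0..} f"
proof (rule strict_mono_onI)
  fix x y :: real assume xy: "x \<in> {0..}" "y \<in> {0..}" "x < y"
  have *: "f (v * y) < v * f y" if "0 < v" "v < 1" for v
  proof -
    have "f ((1 - v) *\<^sub>R 0 + v *\<^sub>R y) < (1 - v) * f 0 + v * f y"
      by (rule conv[unfolded strictly_convex_on_def, THEN conjunct2, rule_format])
         (use xy that in auto)
    then show ?thesis using \<open>f 0 = 0\<close> by simp
  qed
  have "0 < f y"
    using *[of "1/2"] nonneg[of "1/2 * y"] xy by simp
  show "f x < f y"
  proof (cases "x = 0")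
    case True
    then show ?thesis using \<open>0 < f y\<close> \<open>f 0 = 0\<close> by simp
  next
    case False
    have "f (x / y * y) < x / y * f y"
      by (rule *) (use False xy in auto)
    also have "\<dots> \<le> f y"
      using xy \<open>0 < f y\<close> by (simp add: divide_simps)
    finally show ?thesis using xy by simp
  qed
qed

section \<open>Series of shifted ramps\<close>

locale ramp_series =
  fixes a d :: "nat \<Rightarrow> real"
  assumes a_ge: "\<And>n. real n + 1 \<le> a n"
    and d_nonneg: "\<And>n. 0 \<le> d n"
    and d_le: "\<And>n. d n \<le> (1/2)^n"
begin

text \<open>The first summand provides superlinear growth; as \<open>a n\<close> \<ge>
  \<open>n + 1\<close>, only finitely many of these are nonzero on a bounded interval. The second,
  whose shifts accumulate at 0, provides strict convexity down to the origin if the weights are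
  positive; \<open>d n\<close> \<le> \<open>(1/2)^n\<close> makes these summable.\<close>

definition ramp_term :: "nat \<Rightarrow> real \<Rightarrow> real" where
  "ramp_term n s = smooth_ramp (s - a n) + d n * smooth_ramp (s - 1 / (real n + 1))"

definition ramp_term_deriv :: "nat \<Rightarrow> real \<Rightarrow> real" where
  "ramp_term_deriv n s =
     smooth_ramp_deriv (s - a n) + d n * smooth_ramp_deriv (s - 1 / (real n + 1))"

definition ramp_sum :: "real \<Rightarrow> real" where
  "ramp_sum s = (\<Sum>n. ramp_term n s)"

definition ramp_sum_deriv :: "real \<Rightarrow> real" where
  "ramp_sum_deriv s = (\<Sum>n. ramp_term_deriv n s)"

lemma a_pos: "0 < a n"
  using a_ge[of n] by linarith

lemma ramp_term_nonneg: "0 \<le> ramp_term n s"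
  by (simp add: ramp_term_def smooth_ramp_nonneg d_nonneg)

lemma ramp_term_0: "ramp_term n 0 = 0"
  using a_pos[of n] by (simp add: ramp_term_def smooth_ramp_eq_0)

lemma ramp_term_deriv_nonneg: "0 \<le> ramp_term_deriv n s"
  by (simp add: ramp_term_deriv_def smooth_ramp_deriv_nonneg d_nonneg)

lemma continuous_on_ramp_term: "continuous_on A (ramp_term n)"
  unfolding ramp_term_def[abs_def]
  by (intro continuous_intros continuous_on_compose2[OF continuous_on_smooth_ramp[of UNIV]]) auto

lemma continuous_on_ramp_term_deriv: "continuous_on A (ramp_term_deriv n)"
  unfolding ramp_term_deriv_def[abs_def]
  by (intro continuous_intros continuous_on_compose2[OF continuous_on_smooth_ramp_deriv[of UNIV]]) auto

lemma has_real_derivative_ramp_term: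
  "(ramp_term n has_real_derivative ramp_term_deriv n s) (at s)"
proof -
  have "((\<lambda>s. smooth_ramp (s - b)) has_real_derivative smooth_ramp_deriv (s - b)) (at s)" for b
  proof -
    have "((\<lambda>s. s - b) has_real_derivative 1) (at s)"
      by (auto intro!: derivative_eq_intros)
    from DERIV_chain2[OF has_real_derivative_smooth_ramp this] show ?thesis by simp
  qed
  then show ?thesis
    unfolding ramp_term_def[abs_def] ramp_term_deriv_def by (intro DERIV_add DERIV_cmult)
qed

text \<open>For \<open>n\<close> \<ge> \<open>R\<close> the ramp starting at \<open>a n\<close> is
  still flat on \<open>{..<R}\<close>, and what remains is at most \<open>d n\<close>. The finitely
  many earlier terms need no bound in the eventual form of the Weierstrass test.\<close>

lemma uniform_limit_ramp_term_deriv: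
  "uniform_limit {..<R} (\<lambda>n s. \<Sum>i<n. ramp_term_deriv i s) ramp_sum_deriv sequentially"
  unfolding ramp_sum_deriv_def[abs_def]
proof (rule Weierstrass_m_test_ev)
  show "\<forall>\<^sub>F n in sequentially. \<forall>s\<in>{..<R}. norm (ramp_term_deriv n s) \<le> (1/2)^n"
  proof (rule eventually_sequentiallyI)
    fix n assume "nat \<lceil>R\<rceil> \<le> n"
    then have "R \<le> real n" by linarith
    then show "\<forall>s\<in>{..<R}. norm (ramp_term_deriv n s) \<le> (1/2)^n"
    proof (intro ballI)
      fix s assume "s \<in> {..<R}"
      then have "s - a n \<le> 0" using a_ge[of n] \<open>R \<le> real n\<close> by simp
      then have "ramp_term_deriv n s = d n * smooth_ramp_deriv (s - 1 / (real n + 1))"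
        by (simp add: ramp_term_deriv_def smooth_ramp_deriv_eq_0)
      also have "\<dots> \<le> (1/2)^n * 1"
        using d_le by (intro mult_mono) (auto simp: smooth_ramp_deriv_nonneg smooth_ramp_deriv_le_1)
      finally show "norm (ramp_term_deriv n s) \<le> (1/2)^n"
        using ramp_term_deriv_nonneg by simp
    qed
  qed
qed simp

text \<open>Termwise differentiation: the derivative series converges uniformly on
  \<open>{..<R}\<close>, and the series itself converges at 0, where every term vanishes. The
  theorem yields summability and the derivative together.\<close>

lemma
  shows summable_ramp_term: "summable (\<lambda>n. ramp_term n s)"
    and has_real_derivative_ramp_sum: "(ramp_sum has_real_derivative ramp_sum_deriv s) (at s)"
proof -
  \<comment> \<open>With this choice \<open>{..<R}\<close> contains both \<open>s\<close> and the
    base point 0; since it is open, the derivative within it is a full derivative.\<close>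
  define R where "R = \<bar>s\<bar> + 1"
  have "0 < R" "s < R" by (simp_all add: R_def)
  have deriv: "(ramp_term n has_real_derivative ramp_term_deriv n x) (at x within {..<R})" for n x
    by (rule has_field_derivative_at_within[OF has_real_derivative_ramp_term])
  have "\<exists>g. \<forall>x\<in>{..<R}. (\<lambda>n. ramp_term n x) sums g x \<and>
             (g has_field_derivative ramp_sum_deriv x) (at x within {..<R})"
    by (rule has_field_derivative_series[OF _ _ uniform_limit_ramp_term_deriv, of _ _ 0])
       (use \<open>0 < R\<close> in \<open>simp_all add: ramp_term_0 deriv\<close>)
  then obtain g where g: "\<And>x. x < R \<Longrightarrow> (\<lambda>n. ramp_term n x) sums g x"
    "\<And>x. x < R \<Longrightarrow> (g has_field_derivative ramp_sum_deriv x) (at x within {..<R})"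
    by auto
  show "summable (\<lambda>n. ramp_term n s)"
    using \<open>s < R\<close> g(1) sums_summable by blast
  have eq: "g x = ramp_sum x" if "x \<in> {..<R}" for x
    using g(1)[of x] that by (simp add: ramp_sum_def sums_iff)
  have "(g has_field_derivative ramp_sum_deriv s) (at s)"
    using g(2)[of s] \<open>s < R\<close> by (simp add: at_within_open[of s "{..<R}"])
  then show "(ramp_sum has_real_derivative ramp_sum_deriv s) (at s)"
    by (rule has_field_derivative_transform_within_open[of _ _ _ "{..<R}"])
       (use \<open>s < R\<close> eq in auto)
qed

lemma summable_ramp_term_deriv: "summable (\<lambda>n. ramp_term_deriv n s)"
proof -
  have "(\<lambda>n. \<Sum>i<n. ramp_term_deriv i s) \<longlonglongrightarrow> ramp_sum_deriv s"
    by (rule tendsto_uniform_limitI[OF uniform_limit_ramp_term_deriv[of "s + 1"]]) simp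
  then show ?thesis
    by (auto simp: summable_def sums_def)
qed

lemma continuous_on_ramp_sum_deriv: "continuous_on A ramp_sum_deriv"
proof -
  have "isCont ramp_sum_deriv s" for s
  proof -
    have "continuous_on {..<s+1} ramp_sum_deriv"
      by (rule uniform_limit_theorem[OF _ uniform_limit_ramp_term_deriv])
         (auto intro!: always_eventually continuous_on_sum continuous_on_ramp_term_deriv)
    then show ?thesis
      by (simp add: continuous_on_eq_continuous_at)
  qed
  then show ?thesis
    by (simp add: continuous_at_imp_continuous_on)
qed

lemma ramp_term_deriv_mono: "s \<le> t \<Longrightarrow> ramp_term_deriv n s \<le> ramp_term_deriv n t"
  unfolding ramp_term_deriv_def
  by (intro add_mono mult_left_mono smooth_ramp_deriv_mono d_nonneg) auto

lemma ramp_sum_deriv_mono: "s \<le> t \<Longrightarrow> ramp_sum_deriv s \<le> ramp_sum_deriv t"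
  unfolding ramp_sum_deriv_def
  by (intro suminf_le ramp_term_deriv_mono summable_ramp_term_deriv)

text \<open>All terms are nondecreasing, so one strictly increasing term suffices. An index with
  \<open>1 / (real n + 1) < t\<close> gives one, because \<open>t\<close> is then past the flat part
  of the corresponding small ramp.\<close>

lemma ramp_sum_deriv_strict_mono:
  assumes d: "\<And>n. 0 < d n" and st: "s < t" "0 < t"
  shows "ramp_sum_deriv s < ramp_sum_deriv t"
proof -
  obtain n where n: "1 / (real n + 1) < t"
    using reals_Archimedean[OF \<open>0 < t\<close>] by (auto simp: divide_simps mult_ac add.commute)
  have "d n * smooth_ramp_deriv (s - 1 / (real n + 1)) < d n * smooth_ramp_deriv (t - 1 / (real n + 1))"
    using d n st by (intro mult_strict_left_mono smooth_ramp_deriv_strict_mono) auto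
  moreover have "smooth_ramp_deriv (s - a n) \<le> smooth_ramp_deriv (t - a n)"
    using st by (intro smooth_ramp_deriv_mono) auto
  ultimately have "0 < ramp_term_deriv n t - ramp_term_deriv n s"
    by (simp add: ramp_term_deriv_def)
  moreover have "0 \<le> ramp_term_deriv m t - ramp_term_deriv m s" for m
    using ramp_term_deriv_mono[of s t m] st by simp
  ultimately have "0 < (\<Sum>m. ramp_term_deriv m t - ramp_term_deriv m s)"
    by (intro suminf_pos2[of _ n] summable_diff summable_ramp_term_deriv)
  then have "0 < ramp_sum_deriv t - ramp_sum_deriv s"
    unfolding ramp_sum_deriv_def
    by (simp only: suminf_diff[OF summable_ramp_term_deriv summable_ramp_term_deriv])
  then show ?thesis by simp
qed

lemma ramp_sum_nonneg: "0 \<le> ramp_sum s"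
  unfolding ramp_sum_def by (intro suminf_nonneg summable_ramp_term ramp_term_nonneg)

lemma ramp_sum_0: "ramp_sum 0 = 0"
  by (simp add: ramp_sum_def ramp_term_0)

lemma ramp_sum_deriv_nonneg: "0 \<le> ramp_sum_deriv s"
  unfolding ramp_sum_deriv_def by (intro suminf_nonneg summable_ramp_term_deriv ramp_term_deriv_nonneg)

lemma ramp_sum_mono: "s \<le> t \<Longrightarrow> ramp_sum s \<le> ramp_sum t"
  by (rule DERIV_nonneg_imp_nondecreasing)
     (use has_real_derivative_ramp_sum ramp_sum_deriv_nonneg in blast)+

lemma continuously_differentiable_on_ramp_sum: "continuously_differentiable_on S ramp_sum"
  unfolding continuously_differentiable_on_def
  using has_field_derivative_at_within[OF has_real_derivative_ramp_sum] continuous_on_ramp_sum_deriv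
  by blast

lemma convex_on_ramp_sum: "convex_on {0..} ramp_sum"
  by (rule convex_on_realI[OF _ has_real_derivative_ramp_sum])
     (auto intro: ramp_sum_deriv_mono)

lemma strictly_convex_on_ramp_sum:
  assumes "\<And>n. 0 < d n"
  shows "strictly_convex_on {0..} ramp_sum"
  by (rule strictly_convex_on_realI[OF _ has_real_derivative_ramp_sum])
     (auto intro!: strict_mono_onI ramp_sum_deriv_strict_mono assms)

text \<open>The first \<open>m\<close> large ramps already have total slope tending to
  \<open>m\<close>: by \<open>smooth_ramp_ge\<close> their sum is at least \<open>m * s - S\<close>
  with a constant \<open>S\<close>, hence at least \<open>(m - 1) * s\<close> once \<open>s\<close>
  \<ge> \<open>S\<close>.\<close>

lemma filterlim_ramp_sum_divide: "filterlim (\<lambda>s. ramp_sum s / s) at_top at_top"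
  unfolding filterlim_at_top
proof
  fix Z :: real
  obtain m :: nat where m: "Z + 1 \<le> real m"
    using real_arch_simple by blast
  define S where "S = (\<Sum>n<m. a n + 1)"
  have "Z \<le> ramp_sum s / s" if "max 1 S \<le> s" for s
  proof -
    have s: "s > 0" "S \<le> s" using that by auto
    have "Z * s \<le> (real m - 1) * s"
      using m s by (intro mult_right_mono) auto
    also have "\<dots> \<le> real m * s - S"
      using s by (simp add: algebra_simps)
    also have "\<dots> = (\<Sum>n<m. s - a n - 1)"
      by (simp add: S_def sum_subtractf sum.distrib)
    also have "\<dots> \<le> (\<Sum>n<m. ramp_term n s)"
    proof (rule sum_mono)
      fix n
      show "s - a n - 1 \<le> ramp_term n s"
        using smooth_ramp_ge[of "s - a n"] mult_nonneg_nonneg[OF d_nonneg smooth_ramp_nonneg]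
        unfolding ramp_term_def by (rule order_trans[OF _ add_increasing2[OF _ order_refl]])
    qed
    also have "\<dots> \<le> ramp_sum s"
      unfolding ramp_sum_def by (intro sum_le_suminf summable_ramp_term) (auto simp: ramp_term_nonneg)
    finally show ?thesis
      using s by (simp add: divide_simps)
  qed
  then show "\<forall>\<^sub>F s in at_top. Z \<le> ramp_sum s / s"
    unfolding eventually_at_top_linorder by blast
qed

text \<open>A ramp starting at \<open>b\<close> \<ge> 0 vanishes before \<open>b\<close> and is at
  most \<open>s\<close> after it. This form makes integrals of the terms comparable with integrals
  of the identity over \<open>{b..}\<close>.\<close>

lemma ramp_term_le:
  assumes "0 \<le> s"
  shows "ramp_term n s \<le> s * indicator {a n..} s + d n * (s * indicator {1 / (real n + 1)..} s)"
proof -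
  have *: "smooth_ramp (s - b) \<le> s * indicator {b..} s" if "0 \<le> b" for b
    using smooth_ramp_le[of "s - b"] smooth_ramp_eq_0[of "s - b"] that assms
    by (auto simp: indicator_def max_def split: if_splits)
  show ?thesis
    unfolding ramp_term_def
    by (intro add_mono mult_left_mono * d_nonneg) (use a_pos[of n] in auto)
qed

end

section \<open>Measures on the half-line and tail moments\<close>

lemma space_measures_Rplus: "\<nu> \<in> measures_Rplus \<Longrightarrow> space \<nu> = {0..}"
  using sets_eq_imp_space_eq[of \<nu> "restrict_space borel {0..}"]
  by (simp add: measures_Rplus_def space_restrict_space)

lemma borel_measurable_measures_Rplus:
  assumes "\<nu> \<in> measures_Rplus" "f \<in> borel_measurable borel"
  shows "f \<in> borel_measurable \<nu>"
  using measurable_restrict_space1[OF assms(2), of "{0..}"] assms(1)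
  by (simp add: measures_Rplus_def cong: measurable_cong_sets)

lemma sets_measures_Rplus:
  assumes "\<nu> \<in> measures_Rplus" "A \<in> sets borel" "A \<subseteq> {0..}"
  shows "A \<in> sets \<nu>"
  using assms by (auto simp: measures_Rplus_def sets_restrict_space_iff)

text \<open>This is the \<open>G\<close> of the overview. It takes values in \<open>ennreal\<close>
  because it may be infinite for small \<open>M\<close>.\<close>

definition tail_moment :: "real measure set \<Rightarrow> real \<Rightarrow> ennreal" where
  "tail_moment K M = (SUP \<nu>\<in>K. \<integral>\<^sup>+s\<in>{M..}. ennreal s \<partial>\<nu>)"

lemma nn_integral_le_tail_moment:
  "\<nu> \<in> K \<Longrightarrow> (\<integral>\<^sup>+s\<in>{M..}. ennreal s \<partial>\<nu>) \<le> tail_moment K M"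
  unfolding tail_moment_def by (rule SUP_upper)

lemma tail_moment_antimono: "M \<le> N \<Longrightarrow> tail_moment K N \<le> tail_moment K M"
  unfolding tail_moment_def
  by (intro SUP_mono' nn_integral_mono mult_left_mono) (auto simp: indicator_def)

lemma uniformly_integrable_for_id_iff:
  "uniformly_integrable_for (\<lambda>s. s) K \<longleftrightarrow> (tail_moment K \<longlongrightarrow> 0) at_top"
  by (auto simp: uniformly_integrable_for_def tail_moment_def[abs_def] mono_on_def)

text \<open>Nonnegativity allows sum and integral to be exchanged, and \<open>ramp_term_le\<close>
  bounds each term. The maxima arise from intersecting the range of integration \<open>{M..}\<close>
  with the half-line on which a ramp is active.\<close>

lemma (in ramp_series) nn_integral_ramp_sum_le:
  assumes "K \<subseteq> measures_Rplus" "\<nu> \<in> K"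
  shows "(\<integral>\<^sup>+s\<in>{M..}. ennreal (ramp_sum s) \<partial>\<nu>)
    \<le> (\<Sum>n. tail_moment K (max M (a n)) + ennreal (d n) * tail_moment K (max M (1 / (real n + 1))))"
proof -
  have \<nu>: "\<nu> \<in> measures_Rplus" using assms by auto
  have [measurable]: "ramp_term n \<in> borel_measurable borel" for n
    by (intro borel_measurable_continuous_onI continuous_on_ramp_term)
  have meas: "(\<lambda>s. ennreal (ramp_term n s) * indicator {M..} s) \<in> borel_measurable \<nu>" for n
    by (rule borel_measurable_measures_Rplus[OF \<nu>]) measurable
  have meas': "(\<lambda>s. ennreal s * indicator {b..} s) \<in> borel_measurable \<nu>" for b
    by (rule borel_measurable_measures_Rplus[OF \<nu>]) measurable
  have "ennreal (ramp_sum s) = (\<Sum>n. ennreal (ramp_term n s))" for s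
    unfolding ramp_sum_def by (rule suminf_ennreal2[symmetric]) (auto simp: ramp_term_nonneg summable_ramp_term)
  then have "(\<integral>\<^sup>+s\<in>{M..}. ennreal (ramp_sum s) \<partial>\<nu>)
      = (\<integral>\<^sup>+s. (\<Sum>n. ennreal (ramp_term n s) * indicator {M..} s) \<partial>\<nu>)"
    by simp
  also have "\<dots> = (\<Sum>n. \<integral>\<^sup>+s\<in>{M..}. ennreal (ramp_term n s) \<partial>\<nu>)"
    by (rule nn_integral_suminf) (rule meas)
  also have "\<dots> \<le> (\<Sum>n. tail_moment K (max M (a n)) + ennreal (d n) * tail_moment K (max M (1 / (real n + 1))))"
  proof (intro suminf_le)
    fix n
    let ?b = "1 / (real n + 1)"
    have "(\<integral>\<^sup>+s\<in>{M..}. ennreal (ramp_term n s) \<partial>\<nu>)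
        \<le> (\<integral>\<^sup>+s. ennreal s * indicator {max M (a n)..} s
               + ennreal (d n) * (ennreal s * indicator {max M ?b..} s) \<partial>\<nu>)"
    proof (rule nn_integral_mono)
      fix s assume "s \<in> space \<nu>"
      then have s: "0 \<le> s" by (simp add: space_measures_Rplus[OF \<nu>])
      have "ennreal (ramp_term n s) \<le> ennreal (s * indicator {a n..} s + d n * (s * indicator {?b..} s))"
        by (intro ennreal_leI ramp_term_le s)
      also have "\<dots> = ennreal s * indicator {a n..} s + ennreal (d n) * (ennreal s * indicator {?b..} s)"
        using s d_nonneg[of n] by (simp add: ennreal_plus ennreal_mult indicator_def)
      finally show "ennreal (ramp_term n s) * indicator {M..} s \<le> ennreal s * indicator {max M (a n)..} s
               + ennreal (d n) * (ennreal s * indicator {max M ?b..} s)"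
        by (simp add: indicator_def)
    qed
    also have "\<dots> = (\<integral>\<^sup>+s\<in>{max M (a n)..}. ennreal s \<partial>\<nu>)
        + ennreal (d n) * (\<integral>\<^sup>+s\<in>{max M ?b..}. ennreal s \<partial>\<nu>)"
      by (subst nn_integral_add)
         (auto intro!: borel_measurable_times_ennreal meas' simp: nn_integral_cmult[OF meas'])
    also have "\<dots> \<le> tail_moment K (max M (a n)) + ennreal (d n) * tail_moment K (max M ?b)"
      by (intro add_mono mult_left_mono nn_integral_le_tail_moment assms) auto
    finally show "(\<integral>\<^sup>+s\<in>{M..}. ennreal (ramp_term n s) \<partial>\<nu>)
        \<le> tail_moment K (max M (a n)) + ennreal (d n) * tail_moment K (max M ?b)" .
  qed auto
  finally show ?thesis .
qed

section \<open>Construction of a smooth test function\<close>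

lemma suminf_ennreal_geometric_half:
  assumes "\<And>n. f n \<le> ennreal (c * (1/2)^n)" and "0 \<le> c"
  shows "(\<Sum>n. f n) \<le> ennreal (2 * c)"
proof -
  have "(\<lambda>n. (1/2)^n :: real) sums 2"
    using geometric_sums[of "1/2 :: real"] by simp
  from sums_mult[OF this, of c] have sums: "(\<lambda>n. c * (1/2)^n) sums (2 * c)"
    by (simp add: mult.commute)
  have "(\<Sum>n. f n) \<le> (\<Sum>n. ennreal (c * (1/2)^n))"
    by (intro suminf_le assms) auto
  also have "\<dots> = ennreal (\<Sum>n. c * (1/2)^n)"
    using \<open>0 \<le> c\<close> sums by (intro suminf_ennreal2) (auto simp: sums_iff)
  finally show ?thesis using sums by (simp add: sums_iff)
qed

text \<open>The weights \<open>d\<close> remain a parameter so that one construction serves both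
  versions: zero weights give the convex function, positive weights the strictly convex one. The
  assumption \<open>d_tail\<close> keeps the integrals of the added small ramps summable.\<close>

lemma exists_smooth_test_function:
  assumes K: "K \<subseteq> measures_Rplus"
    and lim: "(tail_moment K \<longlongrightarrow> 0) at_top"
    and d_nonneg: "\<And>n. 0 \<le> d n" and d_le: "\<And>n. d n \<le> (1/2)^n"
    and d_tail: "\<And>n. ennreal (d n) * tail_moment K (1 / (real n + 1)) \<le> ennreal ((1/2)^n)"
  shows "\<exists>\<psi>. integrability_test_function \<psi> K \<and> continuously_differentiable_on {0..} \<psi> \<and>
             convex_on {0..} \<psi> \<and> uniformly_integrable_for \<psi> K \<and>
             ((\<forall>n. 0 < d n) \<longrightarrow> strictly_convex_on {0..} \<psi>)"
proof -
  \<comment> \<open>The starting points are pushed out far enough for the tail moments to be small,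
    and beyond \<open>n + 1\<close> as \<open>ramp_series\<close> demands.\<close>
  have "\<exists>x. real n + 1 \<le> x \<and> tail_moment K x \<le> ennreal ((1/4)^n)" for n :: nat
  proof -
    have "\<forall>\<^sub>F x in at_top. tail_moment K x < ennreal ((1/4)^n)"
      by (rule order_tendstoD[OF lim]) simp
    then have "\<forall>\<^sub>F x in at_top. real n + 1 \<le> x \<and> tail_moment K x \<le> ennreal ((1/4)^n)"
      using eventually_ge_at_top[of "real n + 1"] by eventually_elim auto
    then show ?thesis
      by (rule eventually_happens'[OF trivial_limit_at_top_linorder])
  qed
  then obtain a where a: "\<And>n. real n + 1 \<le> a n" "\<And>n. tail_moment K (a n) \<le> ennreal ((1/4)^n)"
    by metis
  interpret ramp_series a d
    using a d_nonneg d_le by unfold_locales auto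
  \<comment> \<open>The rate 1/4 pays for two factors: the minimum of \<open>(1/4)^k\<close> and
    \<open>(1/4)^n\<close> is at most \<open>(1/2)^k * (1/2)^n\<close>, which is summable in
    \<open>n\<close> and still tends to 0 in \<open>k\<close>.\<close>
  have quarter: "(1/4 :: real)^n = (1/2)^n * (1/2)^n" for n
    by (subst power_mult_distrib[symmetric]) simp
  have bounded: "(\<integral>\<^sup>+s\<in>{0..}. ennreal (ramp_sum s) \<partial>\<nu>) \<le> ennreal (2 * 2)" if "\<nu> \<in> K" for \<nu>
  proof (rule order_trans[OF nn_integral_ramp_sum_le[OF K that] suminf_ennreal_geometric_half])
    fix n
    have "tail_moment K (a n) \<le> ennreal ((1/2)^n)"
      using a(2) by (rule order_trans) (auto intro!: ennreal_leI power_mono)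
    then have "tail_moment K (a n) + ennreal (d n) * tail_moment K (1 / (real n + 1))
        \<le> ennreal ((1/2)^n) + ennreal ((1/2)^n)"
      by (intro add_mono d_tail)
    then show "tail_moment K (max 0 (a n)) + ennreal (d n) * tail_moment K (max 0 (1 / (real n + 1)))
        \<le> ennreal (2 * (1/2)^n)"
      using a_pos[of n] by (simp add: max_def flip: ennreal_plus)
  qed simp
  have tail: "(\<integral>\<^sup>+s\<in>{M..}. ennreal (ramp_sum s) \<partial>\<nu>) \<le> ennreal (4 * (1/2)^k)"
    if "\<nu> \<in> K" "a k \<le> M" for \<nu> M k
  proof -
    have M: "tail_moment K (max M b) \<le> ennreal ((1/4)^k)" for b
      by (rule order_trans[OF tail_moment_antimono a(2)]) (use \<open>a k \<le> M\<close> in auto)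
    have "(\<integral>\<^sup>+s\<in>{M..}. ennreal (ramp_sum s) \<partial>\<nu>) \<le> ennreal (2 * (2 * (1/2)^k))"
    proof (rule order_trans[OF nn_integral_ramp_sum_le[OF K that(1)] suminf_ennreal_geometric_half])
      fix n
      have 1: "tail_moment K (max M (a n)) \<le> ennreal ((1/2)^k * (1/2)^n)"
      \<comment> \<open>The smaller of the two available bounds is used: \<open>(1/4)^k\<close> from
        \<open>a k\<close> \<le> \<open>M\<close> in the first case, \<open>(1/4)^n\<close> from the
        choice of \<open>a n\<close> in the second.\<close>
      proof (cases "(1/2 :: real)^k \<le> (1/2)^n")
        case True
        then have "(1/4 :: real)^k \<le> (1/2)^k * (1/2)^n"
          unfolding quarter by (rule mult_left_mono) simp
        then show ?thesis
          by (rule order_trans[OF M ennreal_leI])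
      next
        case False
        then have "(1/4 :: real)^n \<le> (1/2)^k * (1/2)^n"
          unfolding quarter by (intro mult_right_mono) auto
        then have "tail_moment K (a n) \<le> ennreal ((1/2)^k * (1/2)^n)"
          by (rule order_trans[OF a(2) ennreal_leI])
        then show ?thesis
          by (rule order_trans[OF tail_moment_antimono, rotated]) simp
      qed
      \<comment> \<open>For the small ramps the tail moment supplies only the decay in
        \<open>k\<close>; summability in \<open>n\<close> comes from the weight
        \<open>d n\<close>.\<close>
      have "(1/4 :: real)^k \<le> (1/2)^k"
        by (intro power_mono) auto
      then have "tail_moment K (max M (1 / (real n + 1))) \<le> ennreal ((1/2)^k)"
        by (rule order_trans[OF M ennreal_leI])
      then have "ennreal (d n) * tail_moment K (max M (1 / (real n + 1))) \<le> ennreal ((1/2)^n) * ennreal ((1/2)^k)"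
        by (intro mult_mono ennreal_leI d_le) auto
      also have "\<dots> = ennreal ((1/2)^k * (1/2)^n)"
        by (simp add: mult.commute flip: ennreal_mult)
      finally have "tail_moment K (max M (a n)) + ennreal (d n) * tail_moment K (max M (1 / (real n + 1)))
        \<le> ennreal ((1/2)^k * (1/2)^n) + ennreal ((1/2)^k * (1/2)^n)"
        using 1 by (intro add_mono)
      also have "\<dots> = ennreal (2 * (1/2)^k * (1/2)^n)"
        by (simp flip: ennreal_plus)
      finally show "tail_moment K (max M (a n)) + ennreal (d n) * tail_moment K (max M (1 / (real n + 1)))
        \<le> ennreal (2 * (1/2)^k * (1/2)^n)" .
    qed simp
    then show ?thesis by simp
  qed
  have lim0: "((\<lambda>M. SUP \<nu>\<in>K. \<integral>\<^sup>+s\<in>{M..}. ennreal (ramp_sum s) \<partial>\<nu>) \<longlongrightarrow> 0) at_top"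
  proof (rule order_tendstoI)
    fix e :: ennreal assume "0 < e"
    have "(\<lambda>k. ennreal (4 * (1/2)^k)) \<longlonglongrightarrow> ennreal (4 * 0)"
      by (intro tendsto_intros LIMSEQ_power_zero) auto
    from order_tendstoD(2)[OF this, of e] obtain k where k: "ennreal (4 * (1/2)^k) < e"
      using \<open>0 < e\<close> by (auto simp: eventually_sequentially)
    show "\<forall>\<^sub>F M in at_top. (SUP \<nu>\<in>K. \<integral>\<^sup>+s\<in>{M..}. ennreal (ramp_sum s) \<partial>\<nu>) < e"
      using eventually_ge_at_top[of "a k"]
      by eventually_elim (auto intro!: le_less_trans[OF SUP_least k] tail)
  qed auto
  have "(SUP \<nu>\<in>K. \<integral>\<^sup>+s\<in>{0..}. ennreal (ramp_sum s) \<partial>\<nu>) \<le> ennreal (2 * 2)"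
    by (intro SUP_least bounded)
  also have "\<dots> < \<infinity>" by simp
  finally have "(SUP \<nu>\<in>K. \<integral>\<^sup>+s\<in>{0..}. ennreal (ramp_sum s) \<partial>\<nu>) < \<infinity>" .
  moreover have "mono_on {0..} (\<lambda>s. ramp_sum s / s)"
    by (rule convex_on_mono_on_divide_self[OF convex_on_ramp_sum ramp_sum_0 ramp_sum_nonneg])
  moreover have "mono_on {0..} ramp_sum"
    by (intro mono_onI ramp_sum_mono)
  ultimately have "integrability_test_function ramp_sum K"
    unfolding integrability_test_function_def
    by (simp add: ramp_sum_nonneg ramp_sum_0 filterlim_ramp_sum_divide)
  moreover have "uniformly_integrable_for ramp_sum K"
    using lim0 unfolding uniformly_integrable_for_def
    by (auto simp: ramp_sum_nonneg intro!: mono_onI ramp_sum_mono)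
  ultimately show ?thesis
    using continuously_differentiable_on_ramp_sum convex_on_ramp_sum strictly_convex_on_ramp_sum
    by blast
qed

section \<open>Uniform integrability from a test function\<close>

lemma tail_moment_tendsto_0:
  assumes K: "K \<subseteq> measures_Rplus" and \<psi>: "integrability_test_function \<psi> K"
  shows "(tail_moment K \<longlongrightarrow> 0) at_top"
proof (rule order_tendstoI)
  fix e :: ennreal assume "0 < e"
  define I where "I = (SUP \<nu>\<in>K. \<integral>\<^sup>+s\<in>{0..}. ennreal (\<psi> s) \<partial>\<nu>)"
  have "I < \<infinity>" and lim: "filterlim (\<lambda>s. \<psi> s / s) at_top at_top"
    using \<psi> by (auto simp: integrability_test_function_def I_def)
  obtain A where A: "I = ennreal A" "0 \<le> A"
    using \<open>I < \<infinity>\<close> by (cases I) auto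
  have "(\<lambda>n. ennreal (A * inverse (real (Suc n)))) \<longlonglongrightarrow> ennreal (A * 0)"
    by (intro tendsto_intros LIMSEQ_inverse_real_of_nat)
  from order_tendstoD(2)[OF this, of e] obtain n where n: "ennreal (A * inverse (real (Suc n))) < e"
    using \<open>0 < e\<close> by (auto simp: eventually_sequentially)
  \<comment> \<open>The constant is so large that \<open>A / C\<close> is below \<open>e\<close>;
    superlinearity of \<psi> then provides the threshold \<open>M\<close>.\<close>
  define C where "C = real (Suc n)"
  have "C > 0" by (simp add: C_def)
  obtain M where M: "\<And>s. M \<le> s \<Longrightarrow> C \<le> \<psi> s / s"
    using lim by (auto simp: filterlim_at_top eventually_at_top_linorder)
  \<comment> \<open>Beyond \<open>M\<close> one has \<open>C * s\<close> \<le>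
    \<open>\<psi> s\<close>, so \<open>C\<close> times the tail integral is at most
    \<open>A\<close>. The 1 in \<open>max 1 M\<close> keeps \<open>s\<close> positive, so that the
    quotient can be cleared.\<close>
  have le: "(\<integral>\<^sup>+s\<in>{m..}. ennreal s \<partial>\<nu>) \<le> ennreal (A / C)" if "\<nu> \<in> K" "max 1 M \<le> m" for \<nu> m
  proof -
    have \<nu>: "\<nu> \<in> measures_Rplus" using K that by auto
    have "(\<lambda>s. ennreal s * indicator {m..} s) \<in> borel_measurable \<nu>"
      by (rule borel_measurable_measures_Rplus[OF \<nu>]) measurable
    then have "ennreal C * (\<integral>\<^sup>+s\<in>{m..}. ennreal s \<partial>\<nu>)
        = (\<integral>\<^sup>+s. ennreal C * (ennreal s * indicator {m..} s) \<partial>\<nu>)"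
      by (simp add: nn_integral_cmult)
    also have "\<dots> \<le> (\<integral>\<^sup>+s\<in>{0..}. ennreal (\<psi> s) \<partial>\<nu>)"
    proof (rule nn_integral_mono)
      fix s
      have "C * s \<le> \<psi> s" if "m \<le> s"
        using M[of s] that \<open>max 1 M \<le> m\<close> by (simp add: divide_simps split: if_splits)
      then show "ennreal C * (ennreal s * indicator {m..} s) \<le> ennreal (\<psi> s) * indicator {0..} s"
        using \<open>max 1 M \<le> m\<close> \<open>C > 0\<close> by (auto simp: indicator_def ennreal_leI simp flip: ennreal_mult)
    qed
    also have "\<dots> \<le> ennreal A"
      unfolding A(1)[symmetric] I_def by (rule SUP_upper) fact
    finally have *: "ennreal C * (\<integral>\<^sup>+s\<in>{m..}. ennreal s \<partial>\<nu>) \<le> ennreal A" .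
    have "ennreal (1 / C) * (ennreal C * (\<integral>\<^sup>+s\<in>{m..}. ennreal s \<partial>\<nu>)) \<le> ennreal (1 / C) * ennreal A"
      by (rule mult_left_mono[OF *]) simp
    then show ?thesis
      using \<open>C > 0\<close> A by (simp flip: mult.assoc ennreal_mult)
  qed
  show "\<forall>\<^sub>F m in at_top. tail_moment K m < e"
    using eventually_ge_at_top[of "max 1 M"]
  proof eventually_elim
    case (elim m)
    then have "tail_moment K m \<le> ennreal (A / C)"
      unfolding tail_moment_def by (intro SUP_least le) auto
    also have "\<dots> < e" using n by (simp add: C_def divide_inverse)
    finally show ?case .
  qed
qed auto

section \<open>Strict convexity and finiteness of tail masses\<close>

lemma tail_moment_finite:
  assumes K: "K \<subseteq> measures_Rplus" and lim: "(tail_moment K \<longlongrightarrow> 0) at_top"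
    and fin: "\<forall>s>0. (SUP \<nu>\<in>K. emeasure \<nu> {s<..}) < \<infinity>" and "0 < b"
  shows "tail_moment K b < \<infinity>"
proof -
  have "\<forall>\<^sub>F M in at_top. tail_moment K M < 1"
    by (rule order_tendstoD[OF lim]) simp
  then obtain M where M: "tail_moment K M < 1"
    using eventually_happens by force
  \<comment> \<open>The hypothesis concerns open half-lines; the one starting at \<open>b/2\<close>
    contains \<open>{b..}\<close>.\<close>
  define V where "V = (SUP \<nu>\<in>K. emeasure \<nu> {b/2<..})"
  have "V < \<infinity>" using fin \<open>0 < b\<close> by (simp add: V_def)
  \<comment> \<open>The integral is split at \<open>M\<close>: below \<open>M\<close> the integrand
    is at most \<open>M\<close> and the mass at most \<open>V\<close>, and the rest is a tail moment
    already known to be below 1.\<close>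
  have "tail_moment K b \<le> ennreal M * V + tail_moment K M"
    unfolding tail_moment_def[of K b]
  proof (rule SUP_least)
    fix \<nu> assume "\<nu> \<in> K"
    then have \<nu>: "\<nu> \<in> measures_Rplus" using K by auto
    have sets: "{b/2<..} \<in> sets \<nu>"
      by (rule sets_measures_Rplus[OF \<nu>]) (use \<open>0 < b\<close> in auto)
    have meas: "(\<lambda>s. ennreal s * indicator {M..} s) \<in> borel_measurable \<nu>"
      by (rule borel_measurable_measures_Rplus[OF \<nu>]) measurable
    have "(\<integral>\<^sup>+s\<in>{b..}. ennreal s \<partial>\<nu>)
        \<le> (\<integral>\<^sup>+s. ennreal M * indicator {b/2<..} s + ennreal s * indicator {M..} s \<partial>\<nu>)"
      using \<open>0 < b\<close> by (intro nn_integral_mono) (auto simp: indicator_def ennreal_leI)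
    also have "\<dots> = ennreal M * emeasure \<nu> {b/2<..} + (\<integral>\<^sup>+s\<in>{M..}. ennreal s \<partial>\<nu>)"
      using sets meas by (subst nn_integral_add) (auto simp: nn_integral_cmult_indicator)
    also have "\<dots> \<le> ennreal M * V + tail_moment K M"
      unfolding V_def
      by (intro add_mono mult_left_mono nn_integral_le_tail_moment SUP_upper \<open>\<nu> \<in> K\<close>) auto
    finally show "(\<integral>\<^sup>+s\<in>{b..}. ennreal s \<partial>\<nu>) \<le> ennreal M * V + tail_moment K M" .
  qed
  also have "\<dots> < \<infinity>"
    using less_trans[OF M ennreal_one_less_top] \<open>V < \<infinity>\<close> by (simp add: ennreal_mult_less_top)
  finally show ?thesis .
qed

lemma integrability_test_function_strict_mono_on:
  assumes "integrability_test_function \<psi> K" "strictly_convex_on {0..} \<psi>"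
  shows "strict_mono_on {0..} \<psi>"
  using assms
  by (intro strictly_convex_on_imp_strict_mono_on)
     (auto simp: integrability_test_function_def Pi_iff)

text \<open>Markov's inequality for \<psi>: it is at least \<open>\<psi> s\<close> on
  \<open>{s<..}\<close>, and strict convexity makes \<open>\<psi> s\<close> positive, so the bound
  on the integrals can be divided by it.\<close>

lemma Sup_emeasure_finite:
  assumes K: "K \<subseteq> measures_Rplus" and \<psi>: "integrability_test_function \<psi> K"
    and conv: "strictly_convex_on {0..} \<psi>" and "0 < s"
  shows "(SUP \<nu>\<in>K. emeasure \<nu> {s<..}) < \<infinity>"
proof -
  have mono: "mono_on {0..} \<psi>" and "\<psi> 0 = 0"
    and fin: "(SUP \<nu>\<in>K. \<integral>\<^sup>+s\<in>{0..}. ennreal (\<psi> s) \<partial>\<nu>) < \<infinity>" (is "?I < _")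
    using \<psi> by (auto simp: integrability_test_function_def)
  have "0 < \<psi> s"
    using strict_mono_onD[OF integrability_test_function_strict_mono_on[OF \<psi> conv], of 0 s]
      \<open>0 < s\<close> \<open>\<psi> 0 = 0\<close> by simp
  have "(SUP \<nu>\<in>K. emeasure \<nu> {s<..}) \<le> ennreal (1 / \<psi> s) * ?I"
  proof (rule SUP_least)
    fix \<nu> assume "\<nu> \<in> K"
    then have \<nu>: "\<nu> \<in> measures_Rplus" using K by auto
    have sets: "{s<..} \<in> sets \<nu>"
      by (rule sets_measures_Rplus[OF \<nu>]) (use \<open>0 < s\<close> in auto)
    have "ennreal (\<psi> s) * emeasure \<nu> {s<..} = (\<integral>\<^sup>+t. ennreal (\<psi> s) * indicator {s<..} t \<partial>\<nu>)"
      using sets by (simp add: nn_integral_cmult_indicator)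
    also have "\<dots> \<le> (\<integral>\<^sup>+t\<in>{0..}. ennreal (\<psi> t) \<partial>\<nu>)"
      using \<open>0 < s\<close> mono_onD[OF mono, of s]
      by (intro nn_integral_mono) (auto simp: indicator_def ennreal_leI)
    also have "\<dots> \<le> ?I"
      by (rule SUP_upper) fact
    finally have "ennreal (1 / \<psi> s) * (ennreal (\<psi> s) * emeasure \<nu> {s<..}) \<le> ennreal (1 / \<psi> s) * ?I"
      by (rule mult_left_mono) simp
    then show "emeasure \<nu> {s<..} \<le> ennreal (1 / \<psi> s) * ?I"
      using \<open>0 < \<psi> s\<close> by (simp flip: mult.assoc ennreal_mult)
  qed
  also have "\<dots> < \<infinity>"
    using fin by (simp add: ennreal_mult_less_top)
  finally show ?thesis .
qed

text \<open>Finite tail masses make every tail moment at \<open>1 / (real n + 1)\<close> finite, so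
  positive weights can be chosen small enough to compensate for them.\<close>

lemma exists_strictly_convex_test_function:
  assumes K: "K \<subseteq> measures_Rplus" and lim: "(tail_moment K \<longlongrightarrow> 0) at_top"
    and fin: "\<forall>s>0. (SUP \<nu>\<in>K. emeasure \<nu> {s<..}) < \<infinity>"
  shows "\<exists>\<psi>. integrability_test_function \<psi> K \<and> continuously_differentiable_on {0..} \<psi> \<and>
             convex_on {0..} \<psi> \<and> uniformly_integrable_for \<psi> K \<and> strictly_convex_on {0..} \<psi>"
proof -
  define B where "B n = enn2real (tail_moment K (1 / (real n + 1)))" for n
  have B: "tail_moment K (1 / (real n + 1)) = ennreal (B n)" for n
    using tail_moment_finite[OF K lim fin, of "1 / (real n + 1)"] by (simp add: B_def)
  have "0 \<le> B n" for n by (simp add: B_def)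
  then have pos: "0 < 1 + B n" for n by (simp add: add_pos_nonneg)
  \<comment> \<open>This single weight satisfies both \<open>d n\<close> \<le>
    \<open>(1/2)^n\<close> and \<open>d n * B n\<close> \<le> \<open>(1/2)^n\<close>; the added 1
    keeps the denominator positive when \<open>B n = 0\<close>.\<close>
  define d where "d n = (1/2)^n / (1 + B n)" for n
  have d_pos: "0 < d n" for n using pos by (simp add: d_def)
  moreover have "d n \<le> (1/2)^n" for n
    using pos[of n] \<open>0 \<le> B n\<close> by (simp add: d_def divide_simps)
  moreover have "ennreal (d n) * tail_moment K (1 / (real n + 1)) \<le> ennreal ((1/2)^n)" for n
  proof -
    have "d n * B n \<le> (1/2)^n"
      using pos[of n] by (simp add: d_def divide_simps)
    then show ?thesis
      using d_pos[of n] \<open>0 \<le> B n\<close> by (simp add: B ennreal_leI flip: ennreal_mult)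
  qed
  ultimately show ?thesis
    using exists_smooth_test_function[OF K lim, of d] less_imp_le by blast
qed

theorem lemma2p4:
  fixes K :: "real measure set"
  assumes "K \<subseteq> measures_Rplus"
  shows
    "(uniformly_integrable_for (\<lambda>s. s) K \<longleftrightarrow> (\<exists>\<psi>. integrability_test_function \<psi> K))
   \<and> ((\<exists>\<psi>. integrability_test_function \<psi> K) \<longrightarrow>
        (\<exists>\<psi>. integrability_test_function \<psi> K \<and> continuously_differentiable_on {0..} \<psi> \<and>
             convex_on {0..} \<psi> \<and> uniformly_integrable_for \<psi> K))
   \<and> (uniformly_integrable_for (\<lambda>s. s) K \<and> (\<exists>\<psi>. integrability_test_function \<psi> K) \<longrightarrow>
        ((\<exists>\<psi>. integrability_test_function \<psi> K \<and> continuously_differentiable_on {0..} \<psi> \<and>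
              convex_on {0..} \<psi> \<and> uniformly_integrable_for \<psi> K \<and>
              strictly_convex_on {0..} \<psi>)
         \<longleftrightarrow> (\<forall>s>0. (SUP \<nu>\<in>K. emeasure \<nu> {s<..}) < \<infinity>)))
   \<and> (\<forall>\<psi>. integrability_test_function \<psi> K \<and> strictly_convex_on {0..} \<psi> \<longrightarrow>
           strict_mono_on {0..} \<psi>)"
proof -
  \<comment> \<open>Zero weights meet the tail condition even where a tail moment is infinite, since
    the product of 0 and \<infinity> is 0 in \<open>ennreal\<close>.\<close>
  have smooth: "\<exists>\<psi>. integrability_test_function \<psi> K \<and> continuously_differentiable_on {0..} \<psi> \<and>
      convex_on {0..} \<psi> \<and> uniformly_integrable_for \<psi> K" if "(tail_moment K \<longlongrightarrow> 0) at_top"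
    using exists_smooth_test_function[OF assms that, of "\<lambda>_. 0"] by auto
  have iff: "(tail_moment K \<longlongrightarrow> 0) at_top \<longleftrightarrow> (\<exists>\<psi>. integrability_test_function \<psi> K)"
    using smooth tail_moment_tendsto_0[OF assms] by blast
  show ?thesis
    unfolding uniformly_integrable_for_id_iff iff
  proof (intro conjI impI iffI allI)
    fix s :: real
    assume "\<exists>\<psi>. integrability_test_function \<psi> K \<and> continuously_differentiable_on {0..} \<psi> \<and>
      convex_on {0..} \<psi> \<and> uniformly_integrable_for \<psi> K \<and> strictly_convex_on {0..} \<psi>" and "s > 0"
    then show "(SUP \<nu>\<in>K. emeasure \<nu> {s<..}) < \<infinity>"
      using Sup_emeasure_finite[OF assms] by blast
  next
    \<comment> \<open>The conjuncts coincide because uniform integrability of the identity has been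
      rewritten to the existence of a test function.\<close>
    assume "(\<exists>\<psi>. integrability_test_function \<psi> K) \<and> (\<exists>\<psi>. integrability_test_function \<psi> K)"
      and fin: "\<forall>s>0. (SUP \<nu>\<in>K. emeasure \<nu> {s<..}) < \<infinity>"
    then show "\<exists>\<psi>. integrability_test_function \<psi> K \<and> continuously_differentiable_on {0..} \<psi> \<and>
      convex_on {0..} \<psi> \<and> uniformly_integrable_for \<psi> K \<and> strictly_convex_on {0..} \<psi>"
      by (intro exists_strictly_convex_test_function[OF assms _ fin]) (simp add: iff)
  qed (use smooth iff integrability_test_function_strict_mono_on in blast)+
qed

end
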